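(* Let $b\ge 2$ be an integer and let $\phi:\mathbb{R}\to\mathbb{R}^d$ be a non-constant $\mathbb{Z}$-periodic $C^5$ function. Then $p(\phi,b)<d$, and there are at most finitely many $\lambda\in(1/b,1)$ such that $p(\phi,b)<q(\phi,\lambda,b)$.
   Context: For $\lambda\in(1/b,1)$ let $W^{\phi}_{\lambda,b}(x)=\sum_{n=0}^{\infty}\lambda^n\phi(b^nx)$, $x\in\mathbb{R}$. For a linear subspace $V$ of $\mathbb{R}^d$ (with $V=\{0\}$ allowed), $\pi_V$ denotes the orthogonal projection of $\mathbb{R}^d$ onto $V$. Define $$q(\phi,\lambda,b)=\max\{\dim V: V\subset\mathbb{R}^d \text{ a linear subspace such that } \pi_V\circ W^{\phi}_{\lambda,b}\text{ is Lipschitz}\},$$ $$p(\phi,b)=\min_{\lambda\in(1/b,1)}q(\phi,\lambda,b).$$ *)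

theory Defs
  imports "HOL-Analysis.Analysis"
begin

definition Ck :: "nat \<Rightarrow> (real \<Rightarrow> 'a::real_normed_vector) \<Rightarrow> bool" where
  "Ck k f \<longleftrightarrow> (\<exists>D. D 0 = f \<and>
     (\<forall>i<k. \<forall>x. (D i has_vector_derivative D (Suc i) x) (at x)) \<and>
     continuous_on UNIV (D k))"

definition Z_periodic :: "(real \<Rightarrow> 'a) \<Rightarrow> bool" where
  "Z_periodic f \<longleftrightarrow> (\<forall>x. \<forall>k::int. f (x + of_int k) = f x)"

definition weierstrass ::
  "(real \<Rightarrow> 'a::real_normed_vector) \<Rightarrow> real \<Rightarrow> nat \<Rightarrow> real \<Rightarrow> 'a" where
  "weierstrass \<phi> lam b x = (\<Sum>n. lam ^ n *\<^sub>R \<phi> (real b ^ n * x))"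

(* The projection is a well-defined total function when V is a linear subspace:
   see orth_proj_unique_exists. *)
definition orth_proj :: "'a::euclidean_space set \<Rightarrow> 'a \<Rightarrow> 'a" where
  "orth_proj V x = (THE v. v \<in> V \<and> (\<forall>w\<in>V. orthogonal (x - v) w))"

definition lipschitz_dims ::
  "(real \<Rightarrow> 'a::euclidean_space) \<Rightarrow> real \<Rightarrow> nat \<Rightarrow> nat set" where
  "lipschitz_dims \<phi> lam b =
     {dim V | V. subspace V \<and> (\<exists>C. C-lipschitz_on UNIV (orth_proj V \<circ> weierstrass \<phi> lam b))}"

definition q :: "(real \<Rightarrow> 'a::euclidean_space) \<Rightarrow> real \<Rightarrow> nat \<Rightarrow> nat" where
  "q \<phi> lam b = Max (lipschitz_dims \<phi> lam b)"

definition p :: "(real \<Rightarrow> 'a::euclidean_space) \<Rightarrow> nat \<Rightarrow> nat" where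
  "p \<phi> b = Min ((\<lambda>lam. q \<phi> lam b) ` {1 / real b <..< 1})"

lemma orth_proj_unique_exists:
  fixes V :: "'a::euclidean_space set"
  assumes "subspace V"
  shows "\<exists>!v. v \<in> V \<and> (\<forall>w\<in>V. orthogonal (x - v) w)"
proof -
  obtain y z where y: "y \<in> span V" and z: "\<And>w. w \<in> span V \<Longrightarrow> orthogonal z w" and x: "x = y + z"
    using orthogonal_subspace_decomp_exists[of V x] by blast
  have sV: "span V = V" using assms by simp
  show ?thesis
  proof (rule ex1I[of _ y])
    show "y \<in> V \<and> (\<forall>w\<in>V. orthogonal (x - y) w)"
      using y z x sV by auto
  next
    fix v assume v: "v \<in> V \<and> (\<forall>w\<in>V. orthogonal (x - v) w)"
    have d: "v - y \<in> V" using v y sV assms by (auto intro: subspace_diff)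
    have "(x - v) \<bullet> (v - y) = 0" "(x - y) \<bullet> (v - y) = 0"
      using v z[of "v - y"] d x sV by (auto simp: orthogonal_def)
    then have "(v - y) \<bullet> (v - y) = 0"
      by (simp add: inner_diff_left)
    then show "v = y" by simp
  qed
qed

lemma orth_proj_in: "subspace V \<Longrightarrow> orth_proj V x \<in> V"
  and orth_proj_orthogonal: "subspace V \<Longrightarrow> w \<in> V \<Longrightarrow> orthogonal (x - orth_proj V x) w"
  using theI'[OF orth_proj_unique_exists[of V x]] by (auto simp: orth_proj_def)

(* The maximum and minimum in q and p are taken over finite nonempty sets. *)

lemma finite_lipschitz_dims:
  fixes \<phi> :: "real \<Rightarrow> 'a::euclidean_space"
  shows "finite (lipschitz_dims \<phi> lam b)"
  by (rule finite_subset[of _ "{..DIM('a)}"]) (auto simp: lipschitz_dims_def dim_subset_UNIV)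

lemma zero_in_lipschitz_dims:
  fixes \<phi> :: "real \<Rightarrow> 'a::euclidean_space"
  shows "0 \<in> lipschitz_dims \<phi> lam b"
proof -
  have "orth_proj {0} y = 0" for y :: 'a
    using orth_proj_in[OF subspace_single_0, of y] by simp
  then have "0-lipschitz_on UNIV (orth_proj {0} \<circ> weierstrass \<phi> lam b)"
    by (simp add: lipschitz_on_def)
  then show ?thesis
    unfolding lipschitz_dims_def
    by (intro CollectI exI[of _ "{0}"] conjI exI[of _ 0]) simp_all
qed

lemma q_attained: "q \<phi> lam b \<in> lipschitz_dims \<phi> lam b"
  unfolding q_def using zero_in_lipschitz_dims by (metis Max_in finite_lipschitz_dims empty_iff)

lemma q_le:
  fixes \<phi> :: "real \<Rightarrow> 'a::euclidean_space"
  shows "q \<phi> lam b \<le> DIM('a)"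
  using q_attained[of \<phi> lam b] by (auto simp: lipschitz_dims_def dim_subset_UNIV)

lemma p_attained:
  fixes \<phi> :: "real \<Rightarrow> 'a::euclidean_space"
  assumes "b \<ge> 2"
  shows "\<exists>lam\<in>{1 / real b <..< 1}. p \<phi> b = q \<phi> lam b"
proof -
  have "finite ((\<lambda>lam. q \<phi> lam b) ` {1 / real b <..< 1})"
    by (rule finite_subset[of _ "{..DIM('a)}"]) (auto simp: q_le)
  moreover have "{1 / real b <..< 1} \<noteq> {}"
    using assms by simp
  ultimately have "p \<phi> b \<in> (\<lambda>lam. q \<phi> lam b) ` {1 / real b <..< 1}"
    unfolding p_def by (intro Min_in) simp_all
  then show ?thesis by (simp add: image_iff)
qed

end

theory Submission
  imports Defs "HOL-Complex_Analysis.Complex_Analysis"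
begin

text \<open>Let \<open>P g x = (1/b) \<Sum>i<b. g ((x + i)/b)\<close> be the average over the preimages of \<open>x\<close> under
  multiplication by \<open>b\<close> on the circle, a left inverse of the dilation \<open>T g x = g (b x)\<close>. From
  \<open>W = \<phi> + \<lambda> T W\<close> one gets, for \<open>z = 1/\<lambda> < b\<close>, that a Weierstrass function \<open>W\<close> with Lipschitz
  \<open>\<phi>\<close> is Lipschitz iff \<open>(I - T P) (\<Sum>j. z^j P^j \<phi>)\<close> vanishes identically: applying \<open>P^j\<close> and
  telescoping gives one direction, and in the other \<open>- \<Sum>j\<ge>1. z^j (P^j \<phi> - P^j \<phi> 0)\<close> is a
  Lipschitz function that differs from \<open>W\<close> by a constant. Hence \<open>q \<phi> \<lambda> b\<close> is the dimension of
  the common annihilator of the vectors \<open>\<Sum>j. z^j a\<^sub>j(x)\<close>, where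
  \<open>a\<^sub>j = (I - T P) P^j \<phi>\<close>. Averaging a \<open>C^2\<close> periodic function gives \<open>a\<^sub>j = O(b^(-2j))\<close>, so these
  vectors are analytic in \<open>z\<close> on \<open>|z| < b^2\<close>, which contains the compact interval \<open>[1, b]\<close>; the
  dimension therefore exceeds its minimum only at finitely many \<open>z\<close> there. If it were always
  \<open>d\<close>, all \<open>a\<^sub>j\<close> would vanish, so \<open>\<phi> x = P^j \<phi> (b^j x)\<close> for all \<open>j\<close> and \<open>\<phi>\<close> would be constant.\<close>

section \<open>Averaging over preimages\<close>

definition preimage_avg :: "nat \<Rightarrow> (real \<Rightarrow> 'a::real_vector) \<Rightarrow> real \<Rightarrow> 'a" where
  "preimage_avg b g x = (1 / real b) *\<^sub>R (\<Sum>i<b. g ((x + real i) / real b))"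

text \<open>The value \<open>(I - T P) P^j g x\<close>.\<close>

definition defect :: "nat \<Rightarrow> (real \<Rightarrow> 'a::real_vector) \<Rightarrow> real \<Rightarrow> nat \<Rightarrow> 'a" where
  "defect b g x j = (preimage_avg b ^^ j) g x - (preimage_avg b ^^ Suc j) g (real b * x)"

lemma Z_periodicI:
  assumes "\<And>x. g (x + 1) = g x"
  shows "Z_periodic g"
proof -
  have nat: "g (x + real n) = g x" for x n
    by (induction n arbitrary: x) (simp_all add: assms add.assoc[symmetric])
  have "g (x + of_int k) = g x" for x and k :: int
  proof (cases "k \<ge> 0")
    case True
    then show ?thesis using nat[of x "nat k"] by simp
  next
    case False
    then show ?thesis using nat[of "x + of_int k" "nat (- k)"] by simp
  qed
  then show ?thesis by (simp add: Z_periodic_def)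
qed

lemma Z_periodic_frac: "Z_periodic g \<Longrightarrow> g (frac x) = g x"
  unfolding Z_periodic_def frac_def
  by (metis add_uminus_conv_diff of_int_minus)

lemma Z_periodic_nat: "Z_periodic g \<Longrightarrow> g (x + real n) = g x"
  unfolding Z_periodic_def by (metis of_int_of_nat_eq)

text \<open>Translation by 1 moves the preimage with index \<open>i\<close> to the one with index
  \<open>i + 1\<close>; index \<open>b\<close> is index 0 shifted by a period of
  \<open>g\<close>.\<close>

lemma Z_periodic_preimage_avg:
  assumes "b > 0" "Z_periodic g"
  shows "Z_periodic (preimage_avg b g)"
proof (rule Z_periodicI)
  fix x
  let ?h = "\<lambda>i. g ((x + real i) / real b)"
  have eq: "g ((x + 1 + real i) / real b) = ?h (Suc i)" for i
    by (simp add: add_ac)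
  have "?h b = g (x / real b + real 1)"
    using assms(1) by (simp add: add_divide_distrib)
  then have "?h b = ?h 0"
    using Z_periodic_nat[OF assms(2), of "x / real b" 1] by simp
  then have "(\<Sum>i<b. ?h (Suc i)) = (\<Sum>i<b. ?h i)"
    using sum.lessThan_Suc_shift[of ?h b] sum.lessThan_Suc[of ?h b] by simp
  then show "preimage_avg b g (x + 1) = preimage_avg b g x"
    by (simp only: preimage_avg_def eq)
qed

lemma Z_periodic_preimage_avg_funpow:
  "b > 0 \<Longrightarrow> Z_periodic g \<Longrightarrow> Z_periodic ((preimage_avg b ^^ j) g)"
  by (induction j) (simp_all add: Z_periodic_preimage_avg)

lemma lipschitz_preimage_avg:
  fixes g :: "real \<Rightarrow> 'a::real_normed_vector"
  assumes b: "b > 0" and g: "C-lipschitz_on UNIV g"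
  shows "(C / real b)-lipschitz_on UNIV (preimage_avg b g)"
proof (rule lipschitz_onI)
  show "0 \<le> C / real b" using lipschitz_on_nonneg[OF g] by simp
  fix x y :: real
  have *: "norm (g ((x + real i) / real b) - g ((y + real i) / real b)) \<le> C / real b * \<bar>x - y\<bar>" for i
  proof -
    have "(x + real i) / real b - (y + real i) / real b = (x - y) / real b"
      by (simp add: diff_divide_distrib[symmetric])
    then show ?thesis
      using lipschitz_onD[OF g, of "(x + real i) / real b" "(y + real i) / real b"] b
      by (simp add: dist_norm abs_divide)
  qed
  have "norm (preimage_avg b g x - preimage_avg b g y)
      = (1 / real b) * norm (\<Sum>i<b. g ((x + real i) / real b) - g ((y + real i) / real b))"
    unfolding preimage_avg_def by (simp add: sum_subtractf flip: scaleR_diff_right)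
  also have "\<dots> \<le> (1 / real b) * (real b * (C / real b * \<bar>x - y\<bar>))"
    using sum_norm_bound[of "{..<b}" "\<lambda>i. g ((x + real i) / real b) - g ((y + real i) / real b)", OF *]
    by (intro mult_left_mono) simp_all
  finally show "dist (preimage_avg b g x) (preimage_avg b g y) \<le> C / real b * dist x y"
    using b by (simp add: dist_norm)
qed

lemma lipschitz_preimage_avg_funpow:
  fixes g :: "real \<Rightarrow> 'a::real_normed_vector"
  assumes "b > 0" "C-lipschitz_on UNIV g"
  shows "(C / real b ^ j)-lipschitz_on UNIV ((preimage_avg b ^^ j) g)"
proof (induction j)
  case (Suc j)
  show ?case using lipschitz_preimage_avg[OF assms(1) Suc] by (simp add: mult.commute)
qed (use assms in simp)

lemma preimage_avg_dilate:
  assumes "b > 0" "Z_periodic g"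
  shows "preimage_avg b (\<lambda>x. g (real b * x)) = g"
proof
  fix x
  have "g (real b * ((x + real i) / real b)) = g x" for i
    using assms Z_periodic_nat[OF assms(2)] by simp
  then show "preimage_avg b (\<lambda>x. g (real b * x)) x = g x"
    using assms(1) by (simp add: preimage_avg_def sum_constant_scaleR)
qed

text \<open>The shape \<open>u - c v\<close> is that of the functional equation
  \<open>g = W - lam T W\<close>, to which powers of \<open>P\<close> get applied.\<close>

lemma preimage_avg_diff_scaleR:
  "preimage_avg b (\<lambda>x. u x - c *\<^sub>R v x) = (\<lambda>x. preimage_avg b u x - c *\<^sub>R preimage_avg b v x)"
  by (rule ext) (simp add: preimage_avg_def sum_subtractf scaleR_sum_right algebra_simps)

lemma preimage_avg_funpow_diff_scaleR:
  "(preimage_avg b ^^ j) (\<lambda>x. u x - c *\<^sub>R v x)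
     = (\<lambda>x. (preimage_avg b ^^ j) u x - c *\<^sub>R (preimage_avg b ^^ j) v x)"
  by (induction j) (simp_all add: preimage_avg_diff_scaleR)

lemma preimage_avg_linear_image:
  assumes "linear A"
  shows "preimage_avg b (\<lambda>x. A (g x)) = (\<lambda>x. A (preimage_avg b g x))"
  by (rule ext) (simp add: preimage_avg_def linear_sum[OF assms] linear_scale[OF assms])

lemma defect_linear_image:
  assumes "linear A"
  shows "defect b (\<lambda>x. A (g x)) x j = A (defect b g x j)"
proof -
  have *: "(preimage_avg b ^^ j) (\<lambda>x. A (g x)) = (\<lambda>x. A ((preimage_avg b ^^ j) g x))" for j
    by (induction j) (simp_all add: preimage_avg_linear_image[OF assms])
  show ?thesis unfolding defect_def * by (simp add: linear_diff[OF assms])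
qed

text \<open>Put \<open>h = P^j g\<close>. The preimages of \<open>b x\<close> are the points
  \<open>x + i / b\<close>, so the defect is the mean of \<open>h x - h (x + i / b)\<close>,
  differences over distances below 1.\<close>

lemma norm_defect_le:
  fixes g :: "real \<Rightarrow> 'a::real_normed_vector"
  assumes b: "b > 0" and C: "C-lipschitz_on UNIV ((preimage_avg b ^^ j) g)"
  shows "norm (defect b g x j) \<le> C"
proof -
  let ?h = "(preimage_avg b ^^ j) g"
  have C0: "C \<ge> 0" using lipschitz_on_nonneg[OF C] .
  have arg: "(real b * x + real i) / real b = x + real i / real b" for i
    using b by (simp add: add_divide_distrib)
  have "defect b g x j = (1 / real b) *\<^sub>R (\<Sum>i<b. ?h x - ?h (x + real i / real b))"
    using b by (simp add: defect_def preimage_avg_def arg sum_subtractf scaleR_diff_right sum_constant_scaleR)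
  moreover have "norm (\<Sum>i<b. ?h x - ?h (x + real i / real b)) \<le> real (card {..<b}) * C"
  proof (rule sum_norm_bound)
    fix i assume i: "i \<in> {..<b}"
    have "norm (?h x - ?h (x + real i / real b)) \<le> C * (real i / real b)"
      using lipschitz_onD[OF C, of x "x + real i / real b"] by (simp add: dist_norm)
    also have "\<dots> \<le> C * 1"
      using i b C0 by (intro mult_left_mono) auto
    finally show "norm (?h x - ?h (x + real i / real b)) \<le> C" by simp
  qed
  ultimately show ?thesis using b by (simp add: field_simps)
qed

section \<open>Lipschitz Weierstrass functions\<close>

lemma weierstrass_summable:
  fixes g :: "real \<Rightarrow> 'a::banach"
  assumes "\<And>x. norm (g x) \<le> B" "0 < lam" "lam < 1"
  shows "summable (\<lambda>n. lam ^ n *\<^sub>R g (real b ^ n * x))"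
proof (rule summable_comparison_test')
  show "summable (\<lambda>n. lam ^ n * B)" using assms by (intro summable_mult2) simp
  show "norm (lam ^ n *\<^sub>R g (real b ^ n * x)) \<le> lam ^ n * B" for n
    using assms by (simp add: mult_left_mono)
qed

lemma weierstrass_functional_eq:
  fixes g :: "real \<Rightarrow> 'a::banach"
  assumes "\<And>x. norm (g x) \<le> B" "0 < lam" "lam < 1"
  shows "weierstrass g lam b x = g x + lam *\<^sub>R weierstrass g lam b (real b * x)"
proof -
  have sm: "summable (\<lambda>n. lam ^ n *\<^sub>R g (real b ^ n * x))" for x
    by (rule weierstrass_summable[OF assms])
  have "weierstrass g lam b x = (\<Sum>n. lam ^ Suc n *\<^sub>R g (real b ^ Suc n * x)) + g x"
    unfolding weierstrass_def
    using suminf_split_head[OF sm[of x]] by simp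
  also have "(\<Sum>n. lam ^ Suc n *\<^sub>R g (real b ^ Suc n * x)) = lam *\<^sub>R weierstrass g lam b (real b * x)"
    unfolding weierstrass_def
    using suminf_scaleR_right[OF sm[of "real b * x"], of lam]
    by (simp add: mult_ac)
  finally show ?thesis by simp
qed

lemma weierstrass_periodic:
  assumes "Z_periodic g"
  shows "Z_periodic (weierstrass g lam b)"
proof (rule Z_periodicI)
  fix x
  have "g (real b ^ n * (x + 1)) = g (real b ^ n * x)" for n
    using Z_periodic_nat[OF assms, of "real b ^ n * x" "b ^ n"] by (simp add: algebra_simps)
  then show "weierstrass g lam b (x + 1) = weierstrass g lam b x"
    by (simp add: weierstrass_def)
qed

lemma Z_periodic_lipschitz_osc:
  fixes g :: "real \<Rightarrow> 'a::real_normed_vector"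
  assumes "Z_periodic g" and C: "C-lipschitz_on UNIV g"
  shows "norm (g x - g 0) \<le> C"
proof -
  have "norm (g (frac x) - g 0) \<le> C * frac x"
    using lipschitz_onD[OF C, of "frac x" 0] by (simp add: dist_norm)
  also have "\<dots> \<le> C * 1"
    using lipschitz_on_nonneg[OF C] frac_lt_1[of x] by (intro mult_left_mono) simp_all
  finally show ?thesis using Z_periodic_frac[OF assms(1)] by simp
qed

lemma Z_periodic_lipschitz_bounded:
  fixes g :: "real \<Rightarrow> 'a::real_normed_vector"
  assumes "Z_periodic g" "C-lipschitz_on UNIV g"
  shows "norm (g x) \<le> C + norm (g 0)"
  using Z_periodic_lipschitz_osc[OF assms, of x] norm_triangle_sub[of "g x" "g 0"] by linarith

text \<open>Lipschitz continuity alone gives decay like \<open>b^(-j)\<close>, enough for each fixed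
  \<open>lam > 1 / b\<close>. This serves both for \<open>g\<close> and for a Weierstrass function
  assumed Lipschitz.\<close>

lemma defect_summable:
  fixes g :: "real \<Rightarrow> 'a::banach"
  assumes b: "b > 0" and g: "C-lipschitz_on UNIV g" and lam: "1 / real b < lam"
  shows "summable (\<lambda>j. (1 / lam) ^ j *\<^sub>R defect b g x j)"
proof (rule summable_comparison_test')
  have lam0: "lam > 0" using lam b by (smt (verit) divide_nonneg_nonneg of_nat_0_le_iff)
  have "1 / (lam * real b) < 1" using lam lam0 b by (simp add: field_simps)
  then show "summable (\<lambda>j. C * (1 / (lam * real b)) ^ j)"
    using lam0 by (intro summable_mult) simp
  fix j
  have "norm (defect b g x j) \<le> C / real b ^ j"
    by (rule norm_defect_le[OF b lipschitz_preimage_avg_funpow[OF b g]])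
  then have "(1 / lam) ^ j * norm (defect b g x j) \<le> (1 / lam) ^ j * (C / real b ^ j)"
    using lam0 by (intro mult_left_mono) simp_all
  then show "norm ((1 / lam) ^ j *\<^sub>R defect b g x j) \<le> C * (1 / (lam * real b)) ^ j"
    using lam0 by (simp add: power_divide power_mult_distrib)
qed

text \<open>With \<open>w\<close> the Weierstrass function, \<open>g = w - lam T w\<close> and
  \<open>P T = I\<close> turn the defects of \<open>g\<close> into differences of consecutive
  defects of \<open>w\<close>, so the weighted partial sums telescope.\<close>

lemma lipschitz_weierstrass_imp_defect_sum:
  fixes g :: "real \<Rightarrow> 'a::banach"
  assumes b: "b > 0" and per: "Z_periodic g" and g: "C-lipschitz_on UNIV g"
    and lam: "1 / real b < lam" "lam < 1"
    and W: "K-lipschitz_on UNIV (weierstrass g lam b)"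
  shows "(\<Sum>j. (1 / lam) ^ j *\<^sub>R defect b g x j) = 0"
proof -
  have lam0: "lam > 0" using lam b by (smt (verit) divide_nonneg_nonneg of_nat_0_le_iff)
  define w where "w = weierstrass g lam b"
  have wper: "Z_periodic w" unfolding w_def by (rule weierstrass_periodic[OF per])
  have geq: "g = (\<lambda>x. w x - lam *\<^sub>R w (real b * x))"
  proof
    fix x
    show "g x = w x - lam *\<^sub>R w (real b * x)"
      unfolding w_def
      by (subst weierstrass_functional_eq[OF Z_periodic_lipschitz_bounded[OF per g] lam0 lam(2)]) simp
  qed
  have step: "(preimage_avg b ^^ Suc j) g
     = (\<lambda>x. (preimage_avg b ^^ Suc j) w x - lam *\<^sub>R (preimage_avg b ^^ j) w x)" for j
  proof -
    have "preimage_avg b g = (\<lambda>x. preimage_avg b w x - lam *\<^sub>R w x)"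
      unfolding geq preimage_avg_diff_scaleR using preimage_avg_dilate[OF b wper] by simp
    then have "(preimage_avg b ^^ Suc j) g = (preimage_avg b ^^ j) (\<lambda>x. preimage_avg b w x - lam *\<^sub>R w x)"
      by (simp add: funpow_swap1)
    also have "\<dots> = (\<lambda>x. (preimage_avg b ^^ Suc j) w x - lam *\<^sub>R (preimage_avg b ^^ j) w x)"
      unfolding preimage_avg_funpow_diff_scaleR by (simp add: funpow_swap1)
    finally show ?thesis .
  qed
  have rec: "defect b g x (Suc j) = defect b w x (Suc j) - lam *\<^sub>R defect b w x j" for j
    unfolding defect_def step by (simp add: algebra_simps)
  \<comment> \<open>At index 0 the two terms \<open>lam w (b x)\<close> cancel, so the telescope
    leaves nothing at its lower end.\<close>
  have "defect b g x 0 = defect b w x 0"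
    unfolding defect_def using step[of 0] by (simp add: geq)
  then have partial: "(\<Sum>j<Suc n. (1 / lam) ^ j *\<^sub>R defect b g x j) = (1 / lam) ^ n *\<^sub>R defect b w x n" for n
  proof (induction n)
    case (Suc n)
    show ?case
      by (subst sum.lessThan_Suc, subst Suc.IH[OF Suc.prems], subst rec)
        (use lam0 in \<open>simp add: algebra_simps\<close>)
  qed simp
  \<comment> \<open>The surviving last term tends to 0 because \<open>w\<close> is Lipschitz: its
    defects decay like \<open>b^(-n)\<close> and \<open>lam b > 1\<close>.\<close>
  have "(\<lambda>n. (1 / lam) ^ n *\<^sub>R defect b w x n) \<longlonglongrightarrow> 0"
    by (rule summable_LIMSEQ_zero[OF defect_summable[OF b W[folded w_def] lam(1)]])
  then have "(\<lambda>n. \<Sum>j<n. (1 / lam) ^ j *\<^sub>R defect b g x j) \<longlonglongrightarrow> 0"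
    unfolding partial[symmetric] by (rule LIMSEQ_imp_Suc)
  then show ?thesis by (simp add: sums_def sums_unique[symmetric])
qed

text \<open>A bounded Lipschitz solution \<open>\<psi>\<close> of
  \<open>\<psi> - lam T \<psi> = g - g 0\<close> is written down as a series; iterating this
  equation recovers the Weierstrass function up to a constant.\<close>

lemma defect_sum_imp_lipschitz_weierstrass:
  fixes g :: "real \<Rightarrow> 'a::banach"
  assumes b: "b > 0" and per: "Z_periodic g" and g: "C-lipschitz_on UNIV g"
    and lam: "1 / real b < lam" "lam < 1"
    and zero: "\<And>x. (\<Sum>j. (1 / lam) ^ j *\<^sub>R defect b g x j) = 0"
  shows "\<exists>K. K-lipschitz_on UNIV (weierstrass g lam b)"
proof -
  have lam0: "lam > 0" using lam b by (smt (verit) divide_nonneg_nonneg of_nat_0_le_iff)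
  define r where "r = 1 / (lam * real b)"
  have r: "0 \<le> r" "r < 1" using lam lam0 b by (simp_all add: r_def field_simps)
  have C0: "C \<ge> 0" using lipschitz_on_nonneg[OF g] .
  define h where "h j = (preimage_avg b ^^ j) g" for j
  \<comment> \<open>Subtracting the value at 0 leaves the oscillation of \<open>P^j g\<close>, which
    decays like \<open>b^(-j)\<close>; \<open>P^j g\<close> itself need not tend to 0.\<close>
  define d where "d j x = h j x - h j 0" for j x
  have hL: "(C / real b ^ j)-lipschitz_on UNIV (h j)" for j
    unfolding h_def by (rule lipschitz_preimage_avg_funpow[OF b g])
  have rpow: "(1 / lam) ^ j * (C / real b ^ j) = C * r ^ j" for j
    by (simp add: r_def power_divide power_mult_distrib)
  have hper: "Z_periodic (h j)" for j
    unfolding h_def by (rule Z_periodic_preimage_avg_funpow[OF b per])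
  have dbound: "norm ((1 / lam) ^ j *\<^sub>R d j x) \<le> C * r ^ j" for j x
  proof -
    have "(1 / lam) ^ j * norm (d j x) \<le> (1 / lam) ^ j * (C / real b ^ j)"
      unfolding d_def using lam0 Z_periodic_lipschitz_osc[OF hper hL]
      by (intro mult_left_mono) simp_all
    then show ?thesis using lam0 rpow by simp
  qed
  have gsum: "summable (\<lambda>j. C * r ^ j)" using r by (intro summable_mult) simp
  have dsum: "summable (\<lambda>j. (1 / lam) ^ j *\<^sub>R d j x)" for x
    by (rule summable_comparison_test'[OF gsum dbound])
  have dsum': "summable (\<lambda>j. (1 / lam) ^ Suc j *\<^sub>R d (Suc j) x)" for x
    using dsum[of x] by (subst summable_Suc_iff)
  have gsum': "summable (\<lambda>j. C * r ^ Suc j)" using gsum by (subst summable_Suc_iff)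
  define \<psi> where "\<psi> x = - (\<Sum>j. (1 / lam) ^ Suc j *\<^sub>R d (Suc j) x)" for x
  define K where "K = (\<Sum>j. C * r ^ Suc j)"
  have K0: "K \<ge> 0" unfolding K_def
    by (rule suminf_nonneg[OF gsum']) (intro mult_nonneg_nonneg zero_le_power C0 r)
  have \<psi>bound: "norm (\<psi> x) \<le> K" for x
    unfolding \<psi>_def K_def norm_minus_cancel
    by (rule norm_suminf_le[OF dbound gsum'])
  have \<psi>lip: "K-lipschitz_on UNIV \<psi>"
  proof (rule lipschitz_onI[OF _ K0])
    fix x y :: real
    have term_le: "norm ((1 / lam) ^ j *\<^sub>R d j y - (1 / lam) ^ j *\<^sub>R d j x) \<le> C * r ^ j * \<bar>x - y\<bar>" for j
    proof -
      have "norm (d j y - d j x) \<le> C / real b ^ j * \<bar>x - y\<bar>"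
        using lipschitz_onD[OF hL, of y x j] by (simp add: d_def dist_norm abs_minus_commute)
      then have "(1 / lam) ^ j * norm (d j y - d j x)
          \<le> (1 / lam) ^ j * (C / real b ^ j * \<bar>x - y\<bar>)"
        using lam0 by (intro mult_left_mono) simp_all
      also have "\<dots> = C * r ^ j * \<bar>x - y\<bar>"
        unfolding mult.assoc[symmetric] rpow[symmetric] by simp
      finally show ?thesis using lam0 by (simp flip: scaleR_diff_right)
    qed
    have "\<psi> x - \<psi> y = (\<Sum>j. (1 / lam) ^ Suc j *\<^sub>R d (Suc j) y - (1 / lam) ^ Suc j *\<^sub>R d (Suc j) x)"
      unfolding \<psi>_def suminf_diff[OF dsum' dsum', symmetric] by simp
    also have "norm \<dots> \<le> (\<Sum>j. C * r ^ Suc j * \<bar>x - y\<bar>)"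
      by (rule norm_suminf_le[OF term_le summable_mult2[OF gsum']])
    also have "\<dots> = K * \<bar>x - y\<bar>"
      unfolding K_def by (rule suminf_mult2[OF gsum', symmetric])
    finally show "dist (\<psi> x) (\<psi> y) \<le> K * dist x y" by (simp add: dist_norm)
  qed
  have cohom: "\<psi> x - lam *\<^sub>R \<psi> (real b * x) = g x - g 0" for x
  proof -
    have 1: "\<psi> x = d 0 x - (\<Sum>j. (1 / lam) ^ j *\<^sub>R d j x)"
      unfolding \<psi>_def using suminf_split_head[OF dsum[of x]] by simp
    have eq: "lam *\<^sub>R ((1 / lam) ^ Suc j *\<^sub>R d (Suc j) y) = (1 / lam) ^ j *\<^sub>R d (Suc j) y" for j y
      using lam0 by simp
    have s2: "summable (\<lambda>j. (1 / lam) ^ j *\<^sub>R d (Suc j) (real b * x))"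
      using summable_scaleR_right[OF dsum'[of "real b * x"], of lam] unfolding eq .
    have 2: "lam *\<^sub>R \<psi> (real b * x) = - (\<Sum>j. (1 / lam) ^ j *\<^sub>R d (Suc j) (real b * x))"
      unfolding \<psi>_def scaleR_minus_right suminf_scaleR_right[OF dsum'] eq ..
    \<comment> \<open>Since \<open>b * 0 = 0\<close>, the values subtracted at 0 combine to a defect
      at 0. Both defect series vanish by hypothesis, and only \<open>d 0 x\<close> remains.\<close>
    have "d j x - d (Suc j) (real b * x) = defect b g x j - defect b g 0 j" for j
      by (simp add: d_def h_def defect_def)
    then have "(\<Sum>j. (1 / lam) ^ j *\<^sub>R d j x) - (\<Sum>j. (1 / lam) ^ j *\<^sub>R d (Suc j) (real b * x))
        = (\<Sum>j. (1 / lam) ^ j *\<^sub>R defect b g x j - (1 / lam) ^ j *\<^sub>R defect b g 0 j)"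
      unfolding suminf_diff[OF dsum s2] by (simp flip: scaleR_diff_right)
    also have "\<dots> = 0"
      using suminf_diff[OF defect_summable[OF b g lam(1)] defect_summable[OF b g lam(1)], of x 0]
      by (simp add: zero)
    finally show ?thesis unfolding 1 2 by (simp add: d_def h_def algebra_simps)
  qed
  \<comment> \<open>Boundedness of \<open>\<psi>\<close> kills the remainder
    \<open>lam^n \<psi> (b^n x)\<close>; the constant \<open>g 0\<close> contributes a geometric
    series with sum \<open>g 0 / (1 - lam)\<close>.\<close>
  have "weierstrass g lam b x = \<psi> x + (1 / (1 - lam)) *\<^sub>R g 0" for x
  proof -
    have "(\<lambda>n. lam ^ n *\<^sub>R \<psi> (real b ^ n * x)) \<longlonglongrightarrow> 0"
      by (rule summable_LIMSEQ_zero[OF weierstrass_summable[OF \<psi>bound lam0 lam(2)]])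
    from telescope_sums'[OF this]
    have "(\<lambda>n. lam ^ n *\<^sub>R \<psi> (real b ^ n * x) - lam ^ Suc n *\<^sub>R \<psi> (real b ^ Suc n * x)) sums \<psi> x"
      by simp
    moreover have "lam ^ n *\<^sub>R \<psi> (real b ^ n * x) - lam ^ Suc n *\<^sub>R \<psi> (real b ^ Suc n * x)
        = lam ^ n *\<^sub>R (g (real b ^ n * x) - g 0)" for n
      unfolding cohom[symmetric] by (simp add: algebra_simps)
    ultimately have "(\<lambda>n. lam ^ n *\<^sub>R (g (real b ^ n * x) - g 0)) sums \<psi> x" by simp
    moreover have "(\<lambda>n. lam ^ n *\<^sub>R g 0) sums ((1 / (1 - lam)) *\<^sub>R g 0)"
      using lam0 lam(2) by (intro sums_scaleR_left geometric_sums) simp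
    ultimately have "(\<lambda>n. lam ^ n *\<^sub>R (g (real b ^ n * x) - g 0) + lam ^ n *\<^sub>R g 0)
        sums (\<psi> x + (1 / (1 - lam)) *\<^sub>R g 0)"
      by (rule sums_add)
    then show ?thesis
      unfolding weierstrass_def by (simp add: scaleR_diff_right sums_unique[symmetric])
  qed
  then have "K-lipschitz_on UNIV (weierstrass g lam b)"
    using \<psi>lip by (simp add: lipschitz_on_def)
  then show ?thesis ..
qed

section \<open>Averages of differentiable functions\<close>

lemma has_vector_derivative_preimage_avg:
  fixes g :: "real \<Rightarrow> 'a::real_normed_vector"
  assumes b: "b > 0" and g: "\<And>x. (g has_vector_derivative g' x) (at x)"
  shows "(preimage_avg b g has_vector_derivative (1 / real b) *\<^sub>R preimage_avg b g' x) (at x)"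
proof -
  have "((\<lambda>x. g ((x + real i) / real b)) has_vector_derivative
      (1 / real b) *\<^sub>R g' ((x + real i) / real b)) (at x)" for i
  proof -
    have "((\<lambda>x. (x + real i) / real b) has_vector_derivative 1 / real b) (at x)"
      using b by (auto intro!: derivative_eq_intros simp flip: has_real_derivative_iff_has_vector_derivative)
    from vector_diff_chain_at[OF this g] show ?thesis by (simp add: o_def)
  qed
  then have "((\<lambda>x. (1 / real b) *\<^sub>R (\<Sum>i<b. g ((x + real i) / real b))) has_vector_derivative
      (1 / real b) *\<^sub>R (\<Sum>i<b. (1 / real b) *\<^sub>R g' ((x + real i) / real b))) (at x)"
    by (intro bounded_linear.has_vector_derivative[OF bounded_linear_scaleR_right]
        has_vector_derivative_sum)
  then show ?thesis
    unfolding preimage_avg_def[abs_def] by (simp add: scaleR_sum_right)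
qed

lemma has_vector_derivative_preimage_avg_funpow:
  fixes g :: "real \<Rightarrow> 'a::real_normed_vector"
  assumes b: "b > 0" and g: "\<And>x. (g has_vector_derivative g' x) (at x)"
  shows "((preimage_avg b ^^ j) g has_vector_derivative
           (1 / real b ^ j) *\<^sub>R (preimage_avg b ^^ j) g' x) (at x)"
proof (induction j arbitrary: x)
  case (Suc j)
  have "preimage_avg b (\<lambda>x. (1 / real b ^ j) *\<^sub>R (preimage_avg b ^^ j) g' x)
      = (\<lambda>x. (1 / real b ^ j) *\<^sub>R (preimage_avg b ^^ Suc j) g' x)"
    by (rule ext) (simp add: preimage_avg_def scaleR_sum_right mult_ac)
  then show ?case
    using has_vector_derivative_preimage_avg[OF b Suc] by (simp add: mult.commute)
qed (use g in simp)

lemma lipschitz_of_vector_derivative_bound: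
  fixes g :: "real \<Rightarrow> 'a::real_normed_vector"
  assumes g: "\<And>x. (g has_vector_derivative g' x) (at x)" and B: "\<And>x. norm (g' x) \<le> B"
  shows "B-lipschitz_on UNIV g"
proof (rule lipschitz_onI)
  show "0 \<le> B" using B[of 0] norm_ge_zero[of "g' 0"] by linarith
  then have "norm (g x - g y) \<le> B * norm (x - y)" for x y
    using B
    by (intro differentiable_bound[where S = UNIV and f' = "\<lambda>x h. h *\<^sub>R g' x"])
      (auto intro!: onorm_bound simp: mult.commute[of B] mult_left_mono
        g[unfolded has_vector_derivative_def])
  then show "dist (g x) (g y) \<le> B * dist x y" for x y
    by (simp add: dist_norm)
qed

text \<open>The mean of the derivative over a period is zero, so an oscillation bound on the
  derivative bounds the derivative itself.\<close>

lemma Z_periodic_lipschitz_of_derivative_lipschitz: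
  fixes g :: "real \<Rightarrow> 'a::real_normed_vector"
  assumes per: "Z_periodic g"
    and g: "\<And>x. (g has_vector_derivative g' x) (at x)"
    and g': "C-lipschitz_on UNIV g'"
  shows "C-lipschitz_on UNIV g"
proof (rule lipschitz_of_vector_derivative_bound[OF g])
  fix x
  have "norm (g (x + 1) - g x - (x + 1 - x) *\<^sub>R g' x) \<le> norm (x + 1 - x) * C"
  proof (rule vector_differentiable_bound_linearization[where S = "{x..x+1}"])
    show "(g has_vector_derivative g' y) (at y within {x..x+1})" for y
      by (rule has_vector_derivative_at_within[OF g])
    show "norm (g' y - g' x) \<le> C" if "y \<in> {x..x+1}" for y
    proof -
      have "norm (g' y - g' x) \<le> C * \<bar>y - x\<bar>"
        using lipschitz_onD[OF g', of y x] by (simp add: dist_norm)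
      also have "\<dots> \<le> C * 1"
        using that lipschitz_on_nonneg[OF g'] by (intro mult_left_mono) auto
      finally show ?thesis by simp
    qed
  qed (auto simp: closed_segment_eq_real_ivl)
  then show "norm (g' x) \<le> C"
    using Z_periodic_nat[OF per, of x 1] by simp
qed

lemma Z_periodic_derivative:
  assumes per: "Z_periodic g" and g: "\<And>x. (g has_vector_derivative g' x) (at x)"
  shows "Z_periodic g'"
proof (rule Z_periodicI)
  fix x
  have "((\<lambda>x. g (x + 1)) has_vector_derivative 1 *\<^sub>R g' (x + 1)) (at x)"
    using vector_diff_chain_at[of "\<lambda>x. x + 1" 1 x g "g' (x + 1)"] g
    by (simp add: o_def has_vector_derivative_add_const)
  moreover have "(\<lambda>x. g (x + 1)) = g"
    using Z_periodic_nat[OF per, of _ 1] by simp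
  ultimately show "g' (x + 1) = g' x"
    using vector_derivative_unique_at[OF _ g] by simp
qed

lemma Z_periodic_continuous_bounded:
  fixes g :: "real \<Rightarrow> 'a::real_normed_vector"
  assumes "Z_periodic g" "continuous_on UNIV g"
  shows "\<exists>B. \<forall>x. norm (g x) \<le> B"
proof -
  have "bounded (g ` {0..1})"
    by (intro compact_imp_bounded compact_continuous_image continuous_on_subset[OF assms(2)]) auto
  then obtain B where B: "\<And>x. x \<in> {0..1} \<Longrightarrow> norm (g x) \<le> B"
    unfolding bounded_iff by blast
  have "norm (g x) \<le> B" for x
    using B[of "frac x"] frac_lt_1[of x] Z_periodic_frac[OF assms(1), of x] by simp
  then show ?thesis by blast
qed

text \<open>The second derivative is continuous and periodic, hence bounded, and a bound on it is a
  Lipschitz constant for the first.\<close>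

lemma Ck_Z_periodic_lipschitz:
  fixes g :: "real \<Rightarrow> 'a::real_normed_vector"
  assumes k: "k \<ge> 2" and Ck: "Ck k g" and per: "Z_periodic g"
  obtains g' C where "\<And>x. (g has_vector_derivative g' x) (at x)" "C-lipschitz_on UNIV g'"
proof -
  obtain D where D: "D 0 = g" "\<And>i x. i < k \<Longrightarrow> (D i has_vector_derivative D (Suc i) x) (at x)"
    "continuous_on UNIV (D k)"
    using Ck unfolding Ck_def by blast
  have D1: "(g has_vector_derivative D 1 x) (at x)" for x
    using D(2)[of 0 x] k D(1) by simp
  have D2: "(D 1 has_vector_derivative D 2 x) (at x)" for x
    using D(2)[of 1 x] k by (simp add: numeral_2_eq_2)
  have "continuous_on UNIV (D 2)"
  proof (cases "k = 2")
    case False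
    then show ?thesis
      using D(2)[of 2] k
      by (intro continuous_at_imp_continuous_on ballI has_vector_derivative_continuous) auto
  qed (use D(3) in simp)
  then obtain B where "\<And>x. norm (D 2 x) \<le> B"
    using Z_periodic_continuous_bounded
      Z_periodic_derivative[OF Z_periodic_derivative[OF per D1] D2] by blast
  then show ?thesis
    using that[OF D1] lipschitz_of_vector_derivative_bound[OF D2] by blast
qed

text \<open>One factor \<open>b^(-j)\<close> comes from the chain rule, the other from averaging the
  Lipschitz function \<open>g'\<close>; periodicity passes the constant from the derivative to the
  function.\<close>

lemma lipschitz_preimage_avg_funpow_square:
  fixes g :: "real \<Rightarrow> 'a::real_normed_vector"
  assumes b: "b > 0" and per: "Z_periodic g"
    and g: "\<And>x. (g has_vector_derivative g' x) (at x)"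
    and g': "C-lipschitz_on UNIV g'"
  shows "(C * (1 / real b ^ 2) ^ j)-lipschitz_on UNIV ((preimage_avg b ^^ j) g)"
proof (rule Z_periodic_lipschitz_of_derivative_lipschitz)
  show "Z_periodic ((preimage_avg b ^^ j) g)"
    by (rule Z_periodic_preimage_avg_funpow[OF b per])
  show "((preimage_avg b ^^ j) g has_vector_derivative
      (1 / real b ^ j) *\<^sub>R (preimage_avg b ^^ j) g' x) (at x)" for x
    by (rule has_vector_derivative_preimage_avg_funpow[OF b g])
  have "(1 / real b ^ j * (C / real b ^ j))-lipschitz_on UNIV
      (\<lambda>x. (1 / real b ^ j) *\<^sub>R (preimage_avg b ^^ j) g' x)"
    by (intro lipschitz_on_cmult_nonneg lipschitz_preimage_avg_funpow[OF b g']) simp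
  then show "(C * (1 / real b ^ 2) ^ j)-lipschitz_on UNIV
      (\<lambda>x. (1 / real b ^ j) *\<^sub>R (preimage_avg b ^^ j) g' x)"
    by (simp add: power_divide power2_eq_square power_mult_distrib)
qed

section \<open>Annihilators of analytic families\<close>

text \<open>A general division algebra for \<open>z\<close> covers both the real parameters and
  their complex extension.\<close>

lemma geometric_coeff_summable:
  fixes a :: "nat \<Rightarrow> 'a::real_normed_vector" and z :: "'b::real_normed_div_algebra"
  assumes a: "\<And>j. norm (a j) \<le> M * r ^ j" and z: "norm z * r < 1" and r: "r \<ge> 0"
  shows "summable (\<lambda>j. norm (a j) * norm z ^ j)"
proof (rule summable_comparison_test')
  show "summable (\<lambda>j. M * (norm z * r) ^ j)"
    using z r by (intro summable_mult) simp
  show "norm (norm (a j) * norm z ^ j) \<le> M * (norm z * r) ^ j" for j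
    using mult_right_mono[OF a[of j], of "norm z ^ j"] by (simp add: power_mult_distrib mult_ac)
qed

lemma geometric_coeff_sums:
  fixes a :: "nat \<Rightarrow> real" and z :: complex
  assumes a: "\<And>j. norm (a j) \<le> M * r ^ j" and z: "norm z * r < 1" and r: "r \<ge> 0"
  shows "(\<lambda>j. of_real (a j) * z ^ j) sums (\<Sum>j. of_real (a j) * z ^ j)"
proof (rule summable_sums, rule summable_norm_cancel)
  show "summable (\<lambda>j. norm (complex_of_real (a j) * z ^ j))"
    using geometric_coeff_summable[OF assms] by (simp add: norm_mult norm_power)
qed

lemma geometric_coeff_holomorphic:
  fixes a :: "nat \<Rightarrow> real"
  assumes a: "\<And>j. norm (a j) \<le> M * r ^ j" and r: "r > 0"
  shows "(\<lambda>z. \<Sum>j. complex_of_real (a j) * z ^ j) holomorphic_on ball 0 (1 / r)"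
proof (rule power_series_holomorphic)
  fix w :: complex assume "w \<in> ball 0 (1 / r)"
  then have "norm w * r < 1" using r by (simp add: field_simps)
  then show "(\<lambda>j. complex_of_real (a j) * (w - 0) ^ j) sums (\<Sum>j. complex_of_real (a j) * w ^ j)"
    using geometric_coeff_sums[OF a] r by simp
qed

lemma geometric_coeff_suminf_of_real:
  fixes a :: "nat \<Rightarrow> real" and t :: real
  assumes a: "\<And>j. norm (a j) \<le> M * r ^ j" and t: "norm t * r < 1" and r: "r \<ge> 0"
  shows "(\<Sum>j. complex_of_real (a j) * of_real t ^ j) = of_real (\<Sum>j. t ^ j * a j)"
proof -
  have "summable (\<lambda>j. t ^ j * a j)"
    using geometric_coeff_summable[OF a t r]
    by (intro summable_norm_cancel[of "\<lambda>j. t ^ j * a j"]) (simp add: abs_mult power_abs mult.commute)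
  from suminf_of_real[OF this, where 'a = complex] show ?thesis
    by (simp add: mult.commute)
qed

text \<open>Identity theorem: the zeros fill a segment inside the disc of radius
  \<open>1 / r\<close>, so the complex extension vanishes on the disc and has zero
  coefficients.\<close>

lemma power_series_zero_on_interval:
  fixes a :: "nat \<Rightarrow> real"
  assumes a: "\<And>j. norm (a j) \<le> M * r ^ j" and r: "r > 0"
    and uv: "0 \<le> u" "u < v" "v * r < 1"
    and zero: "\<And>t. u < t \<Longrightarrow> t < v \<Longrightarrow> (\<Sum>j. t ^ j * a j) = 0"
  shows "a j = 0"
proof -
  define F where "F z = (\<Sum>j. complex_of_real (a j) * z ^ j)" for z
  have vr: "t * r < 1" if "t \<le> v" for t
    using mult_right_mono[OF that, of r] uv r by linarith
  have hol: "F holomorphic_on ball 0 (1 / r)"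
    unfolding F_def by (rule geometric_coeff_holomorphic[OF a r])
  have F0: "F (of_real t) = 0" if "u < t" "t < v" for t
  proof -
    have "norm t * r < 1"
      using that uv vr[of t] by simp
    then show ?thesis
      unfolding F_def using geometric_coeff_suminf_of_real[OF a] r zero[OF that] by simp
  qed
  have in_ball: "complex_of_real ` {u..v} \<subseteq> ball 0 (1 / r)"
  proof
    fix z assume "z \<in> complex_of_real ` {u..v}"
    then obtain t where t: "z = of_real t" "u \<le> t" "t \<le> v" by auto
    then have "t * r < 1" using vr by simp
    then show "z \<in> ball 0 (1 / r)" using t uv r by (simp add: field_simps)
  qed
  \<comment> \<open>The open segment supplies infinitely many zeros and the closed one is the
    compact set containing them, which rules out a nonconstant \<open>F\<close>.\<close>
  have "infinite (complex_of_real ` {u<..<v})"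
    using uv infinite_Ioo[of u v] by (simp add: finite_image_iff inj_on_def)
  moreover have "complex_of_real ` {u<..<v} \<subseteq> {z \<in> complex_of_real ` {u..v}. F z = 0}"
    using F0 by auto
  ultimately have "infinite {z \<in> complex_of_real ` {u..v}. F z = 0}"
    using finite_subset by blast
  moreover have "compact (complex_of_real ` {u..v})"
    by (intro compact_continuous_image continuous_intros) simp
  ultimately have "F constant_on ball 0 (1 / r)"
    using holomorphic_compact_finite_zeros[OF hol _ _ _ in_ball] by auto
  then obtain c where c: "\<And>z. z \<in> ball 0 (1 / r) \<Longrightarrow> F z = c"
    unfolding constant_on_def by blast
  have "complex_of_real ((u + v) / 2) \<in> ball 0 (1 / r)"
    using uv by (intro subsetD[OF in_ball] imageI) simp
  then have "c = 0" using c F0[of "(u + v) / 2"] uv by auto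
  with c have F_zero: "F z = 0" if "z \<in> ball 0 (1 / r)" for z using that by simp
  have sums: "(\<lambda>n. complex_of_real (a n) * (z - 0) ^ n) sums F z" if "norm (z - 0) < 1 / r" for z
    using geometric_coeff_sums[OF a, of z] that r by (simp add: F_def field_simps)
  \<comment> \<open>A nonzero coefficient of positive index would make the zero at 0 isolated; index
    0 is read off from \<open>F 0\<close> afterwards.\<close>
  have pos: "a m = 0" if "m > 0" for m
  proof (rule ccontr)
    assume am: "a m \<noteq> 0"
    obtain s where s: "0 < s" "\<And>z. z \<in> cball 0 s - {0} \<Longrightarrow> F z \<noteq> 0"
    proof (rule powser_0_nonzero[of "1 / r" 0 "\<lambda>n. complex_of_real (a n)" F m, OF _ sums])
      show "F 0 = 0" using F_zero[of 0] r by simp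
    qed (use r am \<open>m > 0\<close> in simp_all)
    define t where "t = min s (1 / (2 * r))"
    have "0 < t" "t \<le> s" "t < 1 / r"
      using s(1) r by (auto simp: t_def min_def field_simps)
    then show False using s(2)[of "of_real t"] F_zero[of "of_real t"] by auto
  qed
  have "F 0 = of_real (a 0)" by (simp add: F_def)
  then have "a 0 = 0" using F_zero[of 0] r by simp
  with pos show ?thesis by (cases "j = 0") auto
qed

text \<open>The determinant is a polynomial in entries that extend analytically to the disc of
  radius \<open>1 / r\<close>, which contains the compact segment \<open>{u..v}\<close>; the nonzero
  value at \<open>t0\<close> excludes identical vanishing.\<close>

lemma finite_singular_parameters:
  fixes A :: "'d::finite \<Rightarrow> nat \<Rightarrow> real ^ 'd"
  defines "N \<equiv> \<lambda>t::real. \<chi> i. \<Sum>j. t ^ j *\<^sub>R A i j"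
  assumes A: "\<And>i j. norm (A i j) \<le> M * r ^ j" and r: "r > 0"
    and uv: "0 \<le> u" "v * r < 1"
    and t0: "t0 \<in> {u..v}" "det (N t0) \<noteq> 0"
  shows "finite {t \<in> {u..v}. det (N t) = 0}"
proof -
  have comp: "norm (A i j $ k) \<le> M * r ^ j" for i j k
    using A[of i j] component_le_norm_cart[of "A i j" k] by simp
  have vr: "t * r < 1" if "t \<le> v" for t
    using mult_right_mono[OF that, of r] uv r by linarith
  have small: "norm t * r < 1" if "t \<in> {u..v}" for t
    using that uv vr[of t] by simp
  define F where "F z = det (\<chi> i k. \<Sum>j. complex_of_real (A i j $ k) * z ^ j)" for z
  have hol: "F holomorphic_on ball 0 (1 / r)"
    unfolding F_def det_def
    by (auto intro!: holomorphic_intros geometric_coeff_holomorphic[OF comp r])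
  have F_real: "F (of_real t) = of_real (det (N t))" if t: "t \<in> {u..v}" for t
  proof -
    have "summable (\<lambda>j. t ^ j *\<^sub>R A i j)" for i
      using geometric_coeff_summable[where a = "A i" and z = t, OF A small[OF t]] r
      by (intro summable_norm_cancel[of "\<lambda>j. t ^ j *\<^sub>R A i j"]) (simp add: power_abs mult.commute)
    then have "N t $ i $ k = (\<Sum>j. t ^ j * A i j $ k)" for i k
      unfolding N_def
      using bounded_linear.suminf[OF bounded_linear_vec_nth, of "\<lambda>j. t ^ j *\<^sub>R A i j" k]
      by simp
    then show ?thesis
      unfolding F_def det_def
      using geometric_coeff_suminf_of_real[OF comp small[OF t]] r by simp
  qed
  have in_ball: "complex_of_real ` {u..v} \<subseteq> ball 0 (1 / r)"
    using small r by (auto simp: field_simps)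
  have "finite {z \<in> complex_of_real ` {u..v}. F z = 0}"
  proof (cases "F constant_on ball 0 (1 / r)")
    case True
    then obtain c where c: "\<And>z. z \<in> ball 0 (1 / r) \<Longrightarrow> F z = c"
      unfolding constant_on_def by blast
    have "F (of_real t0) = c"
      by (rule c, rule subsetD[OF in_ball], rule imageI, rule t0(1))
    then have "c \<noteq> 0" unfolding F_real[OF t0(1)] using t0(2) by (metis of_real_eq_0_iff)
    then have "F z \<noteq> 0" if "z \<in> complex_of_real ` {u..v}" for z
      using c[OF subsetD[OF in_ball that]] by simp
    then have "{z \<in> complex_of_real ` {u..v}. F z = 0} = {}" by blast
    then show ?thesis by (simp only: finite.emptyI)
  next
    case False
    then show ?thesis
      by (intro holomorphic_compact_finite_zeros[OF hol _ _ _ in_ball] compact_continuous_image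
          continuous_intros) auto
  qed
  moreover have "complex_of_real ` {t \<in> {u..v}. det (N t) = 0} \<subseteq> {z \<in> complex_of_real ` {u..v}. F z = 0}"
    using F_real by auto
  ultimately have "finite (complex_of_real ` {t \<in> {u..v}. det (N t) = 0})"
    using finite_subset by blast
  then show ?thesis by (simp add: finite_image_iff inj_on_def)
qed

text \<open>Complete a basis drawn from the vectors at \<open>t0\<close> by a basis of their annihilator; the
  determinant of the resulting rows is analytic in the parameter and does not vanish at \<open>t0\<close>.\<close>

lemma finite_annihilator_dim_jumps:
  fixes a :: "'i \<Rightarrow> nat \<Rightarrow> real ^ 'd"
  defines "L \<equiv> \<lambda>t::real. {v. \<forall>i. v \<bullet> (\<Sum>j. t ^ j *\<^sub>R a i j) = 0}"
  assumes a: "\<And>i j. norm (a i j) \<le> M * r ^ j" and r: "r > 0"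
    and uv: "0 \<le> u" "v * r < 1"
    and t0: "t0 \<in> {u..v}"
  shows "finite {t \<in> {u..v}. dim (L t0) < dim (L t)}"
proof -
  define U where "U t i = (\<Sum>j. t ^ j *\<^sub>R a i j)" for t i
  have L_alt: "L t = {v. \<forall>i. v \<bullet> U t i = 0}" for t by (simp add: L_def U_def)
  have subL: "subspace (L t)" for t
    by (auto simp: L_alt subspace_def inner_add_left)
  obtain B where B: "B \<subseteq> range (U t0)" "independent B" "range (U t0) \<subseteq> span B" "card B = dim (range (U t0))"
    using basis_exists by blast
  obtain C where C: "C \<subseteq> L t0" "independent C" "L t0 \<subseteq> span C" "card C = dim (L t0)"
    using basis_exists by blast
  have fin: "finite B" "finite C" using B C finiteI_independent by auto
  have orth: "x \<bullet> y = 0" if xy: "x \<in> B" "y \<in> C" for x y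
  proof -
    obtain i where "x = U t0 i" using xy(1) B(1) by blast
    moreover have "y \<bullet> U t0 i = 0" using xy(2) C(1) by (auto simp: L_alt)
    ultimately show ?thesis by (simp add: inner_commute)
  qed
  have "x \<noteq> 0" if "x \<in> B" for x using that B(2) dependent_zero by blast
  with orth have disj: "B \<inter> C = {}" by fastforce
  have perp: "L t0 = {y \<in> UNIV. \<forall>x \<in> span B. orthogonal x y}"
  proof -
    have "(\<forall>x \<in> span B. orthogonal x y) \<longleftrightarrow> (\<forall>i. y \<bullet> U t0 i = 0)" for y
    proof
      assume "\<forall>x \<in> span B. orthogonal x y"
      then show "\<forall>i. y \<bullet> U t0 i = 0"
        using B(3) by (metis inner_commute orthogonal_def rangeI subsetD)
    next
      assume "\<forall>i. y \<bullet> U t0 i = 0"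
      then have "orthogonal y x" if "x \<in> B" for x
        using B(1) that by (auto simp: orthogonal_def)
      then show "\<forall>x \<in> span B. orthogonal x y"
        using orthogonal_to_span[of _ B y] by (auto simp: orthogonal_commute)
    qed
    then show ?thesis by (auto simp: L_alt)
  qed
  \<comment> \<open>\<open>B\<close> and \<open>C\<close> are bases of complementary subspaces, so
    together they number exactly the rows of a square matrix.\<close>
  have "dim (L t0) + dim (span B) = dim (UNIV :: (real ^ 'd) set)"
    unfolding perp by (rule dim_subspace_orthogonal_to_vectors) auto
  then have "card (B \<union> C) = CARD('d)"
    using card_Un_disjoint[OF fin disj] B(2) C(4) by (simp add: dim_eq_card_independent)
  then obtain e where e: "bij_betw e (UNIV :: 'd set) (B \<union> C)"
    using finite_same_card_bij[of "UNIV :: 'd set" "B \<union> C"] fin by auto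
  have e_cases: "e i \<in> B \<or> e i \<in> C" for i
    using e by (auto simp: bij_betw_def)
  \<comment> \<open>Each row in \<open>B\<close> is traced back to an index \<open>i\<close>, so
    that it can follow \<open>U t i\<close> as \<open>t\<close> varies.\<close>
  define w where "w = inv_into UNIV (U t0)"
  have w: "U t0 (w x) = x" if "x \<in> B" for x
    unfolding w_def using B(1) that by (blast intro: f_inv_into_f)
  \<comment> \<open>Rows from \<open>C\<close> stay fixed: they are power series whose only
    coefficient sits at \<open>j = 0\<close>.\<close>
  define A where "A i j = (if e i \<in> B then a (w (e i)) j else if j = 0 then e i else 0)" for i and j :: nat
  define N where "N t = (\<chi> i. \<Sum>j. t ^ j *\<^sub>R A i j)" for t :: real
  have N_B: "N t $ i = U t (w (e i))" if "e i \<in> B" for t i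
    using that by (simp add: N_def A_def U_def)
  have N_C: "N t $ i = e i" if "e i \<notin> B" for t i
  proof -
    have "(\<lambda>j. t ^ j *\<^sub>R A i j) = (\<lambda>j. if j = 0 then e i else 0)"
      using that by (auto simp: A_def)
    moreover have "(\<lambda>j. if j = 0 then e i else 0) sums e i"
      using sums_single[of 0 "\<lambda>_. e i"] by simp
    ultimately show ?thesis by (simp add: N_def sums_iff)
  qed
  have det0: "det (N t0) \<noteq> 0"
  proof -
    \<comment> \<open>A vector killed by every row is orthogonal to \<open>B\<close>, hence lies in
      \<open>L t0\<close>, the span of \<open>C\<close>; being orthogonal to \<open>C\<close> too,
      it is orthogonal to itself.\<close>
    have "inj ((*v) (N t0))"
    proof (rule linear_injective_0[THEN iffD2, OF matrix_vector_mul_linear], intro allI impI)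
      fix y assume y: "N t0 *v y = 0"
      have row: "e i \<bullet> y = 0" for i
      proof -
        have "N t0 $ i = e i" using N_B[of i t0] N_C[of i t0] w by (cases "e i \<in> B") auto
        then show ?thesis
          using arg_cong[OF y, of "\<lambda>x. x $ i"] by (simp add: matrix_vector_mul_component)
      qed
      have "x \<bullet> y = 0" if "x \<in> B \<union> C" for x
        using that row unfolding bij_betw_imp_surj_on[OF e, symmetric] by blast
      then have oB: "\<And>x. x \<in> B \<Longrightarrow> orthogonal y x" and oC: "\<And>x. x \<in> C \<Longrightarrow> orthogonal y x"
        by (auto simp: orthogonal_def inner_commute)
      have "y \<in> L t0"
        unfolding perp using orthogonal_to_span[OF _ oB] by (auto simp: orthogonal_commute)
      then have "orthogonal y y"
        using C(3) orthogonal_to_span[OF _ oC] by blast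
      then show "y = 0" by (simp add: orthogonal_def)
    qed
    then show ?thesis
      using det_nz_iff_inj[OF matrix_vector_mul_linear, of "N t0"] by simp
  qed
  \<comment> \<open>The rows from \<open>B\<close> annihilate \<open>L t\<close>, so an invertible
    \<open>N t\<close> embeds \<open>L t\<close> into the coordinates belonging to \<open>C\<close>,
    of which there are at most \<open>dim (L t0)\<close>.\<close>
  have le: "dim (L t) \<le> dim (L t0)" if "det (N t) \<noteq> 0" for t
  proof -
    have inj: "inj ((*v) (N t))"
      using det_nz_iff_inj[OF matrix_vector_mul_linear, of "N t"] that by simp
    have "(*v) (N t) ` L t \<subseteq> {y. \<forall>i. i \<notin> {i. e i \<in> C} \<longrightarrow> y $ i = 0}"
    proof (intro image_subsetI CollectI allI impI)
      fix y i assume y: "y \<in> L t" and "i \<notin> {i. e i \<in> C}"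
      then have "N t $ i = U t (w (e i))" using e_cases[of i] by (intro N_B) simp
      then show "(N t *v y) $ i = 0"
        using y by (simp add: matrix_vector_mul_component L_alt inner_commute)
    qed
    then have "dim ((*v) (N t) ` L t) \<le> dim {y :: real ^ 'd. \<forall>i. i \<notin> {i. e i \<in> C} \<longrightarrow> y $ i = 0}"
      by (rule dim_subset)
    also have "\<dots> = card {i. e i \<in> C}"
      using dim_substandard_cart[where 'a = real and d = "{i. e i \<in> C}"] by (simp add: dim_vec_eq)
    also have "\<dots> \<le> card C"
      using e fin by (intro card_inj_on_le[of e]) (auto simp: bij_betw_def intro: inj_on_subset)
    finally show ?thesis
      using dim_image_eq[OF matrix_vector_mul_linear, of "N t" "L t"] inj C(4)
      by (simp add: inj_on_subset)
  qed
  \<comment> \<open>The fixed rows contribute only at \<open>j = 0\<close>, where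
    \<open>r ^ 0 = 1\<close>, so any bound on their norms serves.\<close>
  define M' where "M' = max M (\<Sum>x\<in>C. norm x)"
  have A_bound: "norm (A i j) \<le> M' * r ^ j" for i j
  proof (cases "e i \<in> B")
    case True
    then show ?thesis
      using order_trans[OF a[of "w (e i)" j], of "M' * r ^ j"] r
      by (simp add: A_def M'_def mult_right_mono)
  next
    case False
    then have "norm (e i) \<le> (\<Sum>x\<in>C. norm x)"
      using e_cases[of i] fin member_le_sum[of "e i" C norm] by simp
    moreover have "0 \<le> (\<Sum>x\<in>C. norm x)" by (simp add: sum_nonneg)
    ultimately show ?thesis
      using False r by (auto simp: A_def M'_def max_def)
  qed
  have "finite {t \<in> {u..v}. det (N t) = 0}"
    unfolding N_def
    by (rule finite_singular_parameters[OF A_bound r uv t0 det0[unfolded N_def]])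
  then show ?thesis
    by (rule rev_finite_subset) (use le in \<open>auto simp: not_le[symmetric]\<close>)
qed

section \<open>The dimension of the Lipschitz directions\<close>

text \<open>For periodic Lipschitz \<open>g\<close> and \<open>1 / b < lam < 1\<close> this is the
  largest subspace onto which the Weierstrass function has a Lipschitz projection.\<close>

definition lipschitz_directions ::
  "(real \<Rightarrow> 'a::euclidean_space) \<Rightarrow> real \<Rightarrow> nat \<Rightarrow> 'a set" where
  "lipschitz_directions g lam b = {v. \<forall>x. v \<bullet> (\<Sum>j. (1 / lam) ^ j *\<^sub>R defect b g x j) = 0}"

lemma subspace_lipschitz_directions: "subspace (lipschitz_directions g lam b)"
  by (auto simp: lipschitz_directions_def subspace_def inner_add_left)

lemma orth_proj_eqI:
  assumes "subspace V" "v \<in> V" "\<And>w. w \<in> V \<Longrightarrow> orthogonal (x - v) w"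
  shows "orth_proj V x = v"
  unfolding orth_proj_def
  using orth_proj_unique_exists[OF assms(1), of x] assms(2,3) by (intro the1_equality) auto

lemma linear_orth_proj:
  assumes V: "subspace V"
  shows "linear (orth_proj V)"
proof (rule linearI)
  fix x y :: 'a and c :: real
  have *: "(z - orth_proj V z) \<bullet> w = 0" if "w \<in> V" for z w
    using orth_proj_orthogonal[OF V that] by (simp add: orthogonal_def)
  show "orth_proj V (x + y) = orth_proj V x + orth_proj V y"
  proof (rule orth_proj_eqI[OF V subspace_add[OF V orth_proj_in[OF V] orth_proj_in[OF V]]])
    fix w assume "w \<in> V"
    then show "orthogonal (x + y - (orth_proj V x + orth_proj V y)) w"
      using *[of w x] *[of w y] by (simp add: orthogonal_def inner_diff_left inner_add_left)
  qed
  show "orth_proj V (c *\<^sub>R x) = c *\<^sub>R orth_proj V x"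
  proof (rule orth_proj_eqI[OF V subspace_scale[OF V orth_proj_in[OF V]]])
    fix w assume "w \<in> V"
    then show "orthogonal (c *\<^sub>R x - c *\<^sub>R orth_proj V x) w"
      using *[of w x] by (simp add: orthogonal_def flip: scaleR_diff_right)
  qed
qed

lemma orth_proj_eq_0_iff:
  assumes V: "subspace V"
  shows "orth_proj V x = 0 \<longleftrightarrow> (\<forall>v\<in>V. v \<bullet> x = 0)"
proof
  assume "orth_proj V x = 0"
  then show "\<forall>v\<in>V. v \<bullet> x = 0"
    using orth_proj_orthogonal[OF V, of _ x] by (simp add: orthogonal_def inner_commute)
next
  assume "\<forall>v\<in>V. v \<bullet> x = 0"
  then show "orth_proj V x = 0"
    using V by (intro orth_proj_eqI) (auto simp: orthogonal_def inner_commute subspace_0)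
qed

text \<open>The projection is linear and continuous, so it passes through the Weierstrass series,
  the averages and the defect series; the vanishing criterion then applies to the projected
  function.\<close>

lemma lipschitz_proj_weierstrass_iff:
  fixes g :: "real \<Rightarrow> 'a::euclidean_space"
  assumes b: "b > 0" and per: "Z_periodic g" and g: "C-lipschitz_on UNIV g"
    and lam: "1 / real b < lam" "lam < 1"
    and V: "subspace V"
  shows "(\<exists>K. K-lipschitz_on UNIV (orth_proj V \<circ> weierstrass g lam b)) \<longleftrightarrow>
    V \<subseteq> lipschitz_directions g lam b"
proof -
  have lam0: "lam > 0" using lam b by (smt (verit) divide_nonneg_nonneg of_nat_0_le_iff)
  have lin: "linear (orth_proj V)" by (rule linear_orth_proj[OF V])
  have bl: "bounded_linear (orth_proj V)" by (rule linear_conv_bounded_linear[THEN iffD1, OF lin])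
  let ?h = "\<lambda>x. orth_proj V (g x)"
  have hper: "Z_periodic ?h" using per by (simp add: Z_periodic_def)
  obtain D where "D-lipschitz_on UNIV (orth_proj V)"
    using bounded_linear.lipschitz_boundE[OF bl] by blast
  from lipschitz_on_compose2[OF g, of D "orth_proj V"] this
  have hlip: "(D * C)-lipschitz_on UNIV ?h"
    using lipschitz_on_subset by blast
  have "orth_proj V (weierstrass g lam b x) = weierstrass ?h lam b x" for x
    unfolding weierstrass_def
    using bounded_linear.suminf[OF bl weierstrass_summable[OF Z_periodic_lipschitz_bounded[OF per g] lam0 lam(2)]]
    by (simp add: linear_scale[OF lin])
  then have W: "orth_proj V \<circ> weierstrass g lam b = weierstrass ?h lam b" by auto
  have D: "(\<Sum>j. (1 / lam) ^ j *\<^sub>R defect b ?h x j)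
      = orth_proj V (\<Sum>j. (1 / lam) ^ j *\<^sub>R defect b g x j)" for x
    unfolding defect_linear_image[OF lin]
    using bounded_linear.suminf[OF bl defect_summable[OF b g lam(1)], of x]
    by (simp add: linear_scale[OF lin])
  have "(\<exists>K. K-lipschitz_on UNIV (weierstrass ?h lam b)) \<longleftrightarrow>
      (\<forall>x. (\<Sum>j. (1 / lam) ^ j *\<^sub>R defect b ?h x j) = 0)"
    using lipschitz_weierstrass_imp_defect_sum[OF b hper hlip lam]
      defect_sum_imp_lipschitz_weierstrass[OF b hper hlip lam] by blast
  then show ?thesis
    unfolding W D orth_proj_eq_0_iff[OF V] lipschitz_directions_def by blast
qed

text \<open>The admissible \<open>V\<close> are exactly the subspaces of
  \<open>lipschitz_directions g lam b\<close>, so this space itself attains the maximum.\<close>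

lemma q_eq_dim_lipschitz_directions:
  fixes g :: "real \<Rightarrow> 'a::euclidean_space"
  assumes "b > 0" "Z_periodic g" "C-lipschitz_on UNIV g" "1 / real b < lam" "lam < 1"
  shows "q g lam b = dim (lipschitz_directions g lam b)"
  unfolding q_def
proof (rule Max_eqI[OF finite_lipschitz_dims])
  note iff = lipschitz_proj_weierstrass_iff[OF assms]
  show "n \<le> dim (lipschitz_directions g lam b)" if "n \<in> lipschitz_dims g lam b" for n
    using that iff by (auto simp: lipschitz_dims_def intro: dim_subset)
  show "dim (lipschitz_directions g lam b) \<in> lipschitz_dims g lam b"
    using iff[OF subspace_lipschitz_directions] subspace_lipschitz_directions
    unfolding lipschitz_dims_def by blast
qed

text \<open>With zero defects every value of \<open>g\<close> is a value of \<open>P^j g\<close>,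
  whose deviation from its value at 0 is at most \<open>C / b^j\<close>.\<close>

lemma defect_zero_imp_constant:
  fixes g :: "real \<Rightarrow> 'a::real_normed_vector"
  assumes b: "b \<ge> 2" and per: "Z_periodic g" and g: "C-lipschitz_on UNIV g"
    and zero: "\<And>x j. defect b g x j = 0"
  shows "g constant_on UNIV"
proof -
  have step: "g x = (preimage_avg b ^^ j) g (real b ^ j * x)" for x j
  proof (induction j)
    case (Suc j)
    then show ?case
      using zero[of "real b ^ j * x" j] by (simp add: defect_def mult_ac)
  qed simp
  have "g x = g 0" for x
  proof -
    have "norm (g x - g 0) \<le> C / real b ^ j" for j
      using Z_periodic_lipschitz_osc[OF Z_periodic_preimage_avg_funpow[OF _ per]
          lipschitz_preimage_avg_funpow[OF _ g], of b j "real b ^ j * x"] step[of x j] step[of 0 j] b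
      by simp
    moreover have "(\<lambda>j. C / real b ^ j) \<longlonglongrightarrow> 0"
      using LIMSEQ_divide_realpow_zero[of "real b" C] b by simp
    ultimately have "norm (g x - g 0) \<le> 0"
      by (intro LIMSEQ_le_const[of _ 0]) auto
    then show ?thesis by simp
  qed
  then show ?thesis unfolding constant_on_def by blast
qed

theorem theorem2:
  fixes b :: nat and \<phi> :: "real \<Rightarrow> real ^ 'd"
  assumes "b \<ge> 2"
    and "Z_periodic \<phi>"
    and "Ck 5 \<phi>"
    and "\<not> \<phi> constant_on UNIV"
  shows "p \<phi> b < CARD('d) \<and>
    finite {lam \<in> {1 / real b <..< 1}. p \<phi> b < q \<phi> lam b}"
proof -
  have b: "b > 0" and b1: "real b > 1" using assms(1) by simp_all
  obtain \<phi>' C where \<phi>': "\<And>x. (\<phi> has_vector_derivative \<phi>' x) (at x)" "C-lipschitz_on UNIV \<phi>'"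
    using Ck_Z_periodic_lipschitz[OF _ assms(3,2)] by auto
  have lip: "C-lipschitz_on UNIV \<phi>"
    by (rule Z_periodic_lipschitz_of_derivative_lipschitz[OF assms(2) \<phi>'])
  \<comment> \<open>With this rate \<open>b * r = 1 / b < 1\<close>, so the closed interval from 1
    to \<open>b\<close> lies inside the disc of radius \<open>1 / r = b^2\<close>.\<close>
  define r where "r = 1 / real b ^ 2"
  have r: "r > 0" "real b * r < 1"
    using b1 by (simp_all add: r_def power2_eq_square)
  have bound: "norm (defect b \<phi> x j) \<le> C * r ^ j" for x j
    unfolding r_def
    by (rule norm_defect_le[OF b lipschitz_preimage_avg_funpow_square[OF b assms(2) \<phi>']])
  let ?L = "\<lambda>lam. lipschitz_directions \<phi> lam b"
  have q_eq: "q \<phi> lam b = dim (?L lam)" if "lam \<in> {1 / real b <..< 1}" for lam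
    using q_eq_dim_lipschitz_directions[OF b assms(2) lip] that by simp
  obtain lam0 where lam0: "lam0 \<in> {1 / real b <..< 1}" and p_eq: "p \<phi> b = q \<phi> lam0 b"
    using p_attained[OF assms(1)] by blast
  have p_le: "p \<phi> b \<le> q \<phi> lam b" if "lam \<in> {1 / real b <..< 1}" for lam
  proof -
    have "finite ((\<lambda>lam. q \<phi> lam b) ` {1 / real b <..< 1})"
      by (rule finite_subset[of _ "{..DIM(real ^ 'd)}"]) (use q_le[of \<phi>] in auto)
    then show ?thesis unfolding p_def using that by (intro Min_le) auto
  qed
  \<comment> \<open>The substitution \<open>t = 1 / lam\<close> sends the open parameter range into
    a compact interval within the disc, so exceptional parameters cannot accumulate at either
    end.\<close>
  have inv_mem: "1 / lam \<in> {1..real b}" "1 / lam > 1" if "lam \<in> {1 / real b <..< 1}" for lam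
  proof -
    have "lam > 0" using that b1 by (smt (verit) divide_pos_pos greaterThanLessThan_iff)
    then show "1 / lam \<in> {1..real b}" "1 / lam > 1" using that b1 by (auto simp: field_simps)
  qed
  have "p \<phi> b < CARD('d)"
  proof (rule ccontr)
    assume "\<not> p \<phi> b < CARD('d)"
    then have full: "?L lam = UNIV" if "lam \<in> {1 / real b <..< 1}" for lam
      using p_le[OF that] q_eq[OF that] dim_subset_UNIV[of "?L lam"]
        dim_eq_full[of "?L lam"] span_eq_iff[THEN iffD2, OF subspace_lipschitz_directions[of \<phi> lam b]]
      by simp
    have "defect b \<phi> x j $ k = 0" for x j k
    proof (rule power_series_zero_on_interval[where a = "\<lambda>j. defect b \<phi> x j $ k"])
      show "norm (defect b \<phi> x j $ k) \<le> C * r ^ j" for j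
        using bound[of x j] component_le_norm_cart[of "defect b \<phi> x j" k] by simp
      fix t :: real assume t: "1 < t" "t < real b"
      then have mem: "1 / t \<in> {1 / real b <..< 1}" by (simp add: field_simps)
      \<comment> \<open>Testing against the \<open>k\<close>-th coordinate vector makes the
        \<open>k\<close>-th component of the series vanish for all \<open>t\<close> strictly between
        1 and \<open>b\<close>.\<close>
      have "axis k 1 \<in> ?L (1 / t)" using full[OF mem] by simp
      then have "(\<Sum>j. t ^ j *\<^sub>R defect b \<phi> x j) $ k = 0"
        unfolding lipschitz_directions_def by (simp add: inner_axis')
      moreover have "summable (\<lambda>j. t ^ j *\<^sub>R defect b \<phi> x j)"
        using defect_summable[OF b lip, of "1 / t" x] mem by simp
      ultimately show "(\<Sum>j. t ^ j * defect b \<phi> x j $ k) = 0"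
        using bounded_linear.suminf[OF bounded_linear_vec_nth, of "\<lambda>j. t ^ j *\<^sub>R defect b \<phi> x j" k] by simp
    qed (use r b1 in auto)
    then have "defect b \<phi> x j = 0" for x j by (simp add: vec_eq_iff)
    then show False
      using defect_zero_imp_constant[OF assms(1,2) lip] assms(4) by blast
  qed
  moreover have "finite {lam \<in> {1 / real b <..< 1}. p \<phi> b < q \<phi> lam b}"
  proof -
    let ?Ann = "\<lambda>t. {v. \<forall>x. v \<bullet> (\<Sum>j. t ^ j *\<^sub>R defect b \<phi> x j) = 0}"
    have "finite {t \<in> {1..real b}. dim (?Ann (1 / lam0)) < dim (?Ann t)}"
      by (rule finite_annihilator_dim_jumps[OF bound r(1) _ r(2) inv_mem(1)[OF lam0]]) simp
    \<comment> \<open>Since \<open>p\<close> is attained at \<open>lam0\<close>, exceeding it means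
      a jump above the annihilator dimension at \<open>1 / lam0\<close>; inversion is injective, so
      finiteness pulls back to \<open>lam\<close>.\<close>
    moreover have "(\<lambda>lam. 1 / lam) ` {lam \<in> {1 / real b <..< 1}. p \<phi> b < q \<phi> lam b}
        \<subseteq> {t \<in> {1..real b}. dim (?Ann (1 / lam0)) < dim (?Ann t)}"
      using inv_mem(1) q_eq lam0 unfolding p_eq by (auto simp: lipschitz_directions_def)
    ultimately have "finite ((\<lambda>lam. 1 / lam) ` {lam \<in> {1 / real b <..< 1}. p \<phi> b < q \<phi> lam b})"
      by (rule rev_finite_subset)
    then show ?thesis
      by (rule finite_imageD) (simp add: inj_on_def)
  qed
  ultimately show ?thesis ..
qed

end
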